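(* Let $i\ge 1$ be an integer and $n=9i+5$. The $n$-vertex threshold graphs $G=(0\, 1^{2i+1}0^i 1^{2i+2} 0^{2i+1} 1^{2i})$ and $G'=(0\, 1^{2i}0^{i+1} 1^{2i} 0^{2i+1} 1^{2i+2})$ are noncospectral (their adjacency matrices have different spectra) and equienergetic, i.e. $E(G)=E(G')$.
   Context: A threshold graph on $N$ vertices is coded by a binary sequence $(b_1 b_2 \ldots b_N)$ with $b_1=0$: vertices $v_1,\dots,v_N$ are added in order, and for $j\ge 2$ the vertex $v_j$ is added as an isolated vertex if $b_j=0$ and as a dominating vertex (adjacent to all of $v_1,\dots,v_{j-1}$) if $b_j=1$. The notation $(0\,1^{a_2} 0^{a_3} 1^{a_4}\cdots)$ denotes the sequence consisting of one zero, followed by $a_2$ ones, followed by $a_3$ zeros, etc. The energy of a graph $H$ on $m$ vertices is $E(H)=\sum_{k=1}^m|\lambda_k|$, where $\lambda_1,\dots,\lambda_m$ are the eigenvalues of its adjacency matrix. *)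

theory Defs
  imports
    "Graph_Theory.Pair_Digraph"
    "Jordan_Normal_Form.Char_Poly"
    "HOL-Computational_Algebra.Fundamental_Theorem_Algebra"
begin

text \<open>
  Undirected simple graphs are represented as in \<^theory>\<open>Graph_Theory.Pair_Digraph\<close> by symmetric,
  loop-free sets of arcs (locale \<^locale>\<open>pair_graph\<close>). Positions in the binary sequence are
  counted from 0, so vertex \<open>j\<close> is added according to the bit \<open>b ! j\<close>, with \<open>True\<close> for 1. The
  first bit has no influence on the graph, since the first vertex has no predecessors.
\<close>

definition threshold_graph :: "bool list \<Rightarrow> nat pair_pre_digraph" where
  "threshold_graph b = \<lparr>
     pverts = {0..<length b},
     parcs = {(k, j). k < j \<and> j < length b \<and> b ! j} \<union> {(j, k). k < j \<and> j < length b \<and> b ! j} \<rparr>"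

lemma pverts_threshold_graph [simp]: "pverts (threshold_graph b) = {0..<length b}"
  by (simp add: threshold_graph_def)

lemma pair_graph_threshold_graph: "pair_graph (threshold_graph b)"
proof
  show "finite (parcs (threshold_graph b))"
    by (rule finite_subset[of _ "{0..<length b} \<times> {0..<length b}"])
       (auto simp: threshold_graph_def)
qed (auto simp: threshold_graph_def symmetric_def sym_def)

text \<open>The vertices index the rows and columns in increasing order.\<close>

definition adjacency_matrix :: "'a :: linorder pair_pre_digraph \<Rightarrow> complex mat" where
  "adjacency_matrix H = (let vs = sorted_list_of_set (pverts H) in
     mat (length vs) (length vs) (\<lambda>(k, l). if (vs ! k, vs ! l) \<in> parcs H then 1 else 0))"

text \<open>
  The multiset of eigenvalues, with algebraic multiplicities. The matrix is taken over the complex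
  numbers so that there are as many eigenvalues as vertices.
\<close>

definition adjacency_spectrum :: "'a :: linorder pair_pre_digraph \<Rightarrow> complex multiset" where
  "adjacency_spectrum H = proots (char_poly (adjacency_matrix H))"

lemma size_adjacency_spectrum: "size (adjacency_spectrum H) = card (pverts H)"
proof -
  have "adjacency_matrix H \<in> carrier_mat (card (pverts H)) (card (pverts H))"
    by (simp add: adjacency_matrix_def Let_def)
  from degree_monic_char_poly[OF this] show ?thesis
    by (simp add: adjacency_spectrum_def size_proots_complex)
qed

lemma set_adjacency_spectrum:
  "set_mset (adjacency_spectrum H) = Collect (eigenvalue (adjacency_matrix H))"
proof -
  have A: "adjacency_matrix H \<in> carrier_mat (card (pverts H)) (card (pverts H))"
    by (simp add: adjacency_matrix_def Let_def)
  from degree_monic_char_poly[OF A] have "char_poly (adjacency_matrix H) \<noteq> 0"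
    by auto
  then show ?thesis
    by (auto simp: adjacency_spectrum_def eigenvalue_root_char_poly[OF A])
qed

definition cospectral :: "'a :: linorder pair_pre_digraph \<Rightarrow> 'b :: linorder pair_pre_digraph \<Rightarrow> bool" where
  "cospectral G H \<longleftrightarrow> adjacency_spectrum G = adjacency_spectrum H"

definition energy :: "'a :: linorder pair_pre_digraph \<Rightarrow> real" where
  "energy H = (\<Sum>x\<in>#adjacency_spectrum H. cmod x)"

definition equienergetic :: "'a :: linorder pair_pre_digraph \<Rightarrow> 'b :: linorder pair_pre_digraph \<Rightarrow> bool" where
  "equienergetic G H \<longleftrightarrow> energy G = energy H"

end

theory Submission
  imports Defs
begin

text \<open>
  Let \<open>M = x I - A\<close> be the characteristic matrix of a threshold graph, \<open>p = det M\<close> and \<open>s\<close> the sum of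
  all entries of \<open>adj M\<close>. Adding an isolated vertex turns \<open>(p, s)\<close> into \<open>(x p, x s + p)\<close>, adding a
  dominating one turns it into \<open>(x p - s, (x + 2) s + p)\<close>. Iterating these linear maps along the
  blocks of the sequences shows that the characteristic polynomials are \<open>r (x + 1) (x + 2 i + 1)\<close>
  and \<open>r x (x + 2 i + 2)\<close> with the same cofactor \<open>r\<close>. So the spectra differ in \<open>{-1, -(2 i + 1)}\<close>
  versus \<open>{0, -(2 i + 2)}\<close>, and both pairs contribute \<open>2 i + 2\<close> to the energy.
\<close>

section \<open>Bordered determinants and the recursion for the characteristic polynomial\<close>

text \<open>
  The vector \<open>y\<close> plays the role of \<open>adj A\<close> applied to the all-ones vector; keeping it explicit allows
  elimination without dividing by \<open>p\<close>.
\<close>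

lemma det_border_constant:
  fixes a :: "nat \<Rightarrow> nat \<Rightarrow> 'a :: idom"
  assumes det: "det (mat n n (\<lambda>(k, l). a k l)) = p" and "p \<noteq> 0"
    and y: "\<And>k. k < n \<Longrightarrow> (\<Sum>l<n. a k l * y l) = p" and s: "(\<Sum>l<n. y l) = s"
    and col: "\<And>k. k < n \<Longrightarrow> a k n = u" and row: "\<And>l. l < n \<Longrightarrow> a n l = u" and "a n n = w"
  shows "det (mat (Suc n) (Suc n) (\<lambda>(k, l). a k l)) = w * p - u\<^sup>2 * s"
proof -
  \<comment> \<open>Right multiplication by \<open>U\<close> scales the last column by
    \<open>p\<close> and subtracts \<open>u\<close> times the image of \<open>y\<close>, which
    clears it above the corner. The factor \<open>det U = p\<close> is cancelled at the end.\<close>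
  define U where "U = four_block_mat (1\<^sub>m n) (mat n 1 (\<lambda>(k, _). - u * y k)) (0\<^sub>m 1 n) (mat 1 1 (\<lambda>_. p))"
  define L where "L = four_block_mat (mat n n (\<lambda>(k, l). a k l)) (0\<^sub>m n 1) (mat 1 n (\<lambda>_. u))
    (mat 1 1 (\<lambda>_. w * p - u\<^sup>2 * s))"
  let ?B = "mat (Suc n) (Suc n) (\<lambda>(k, l). a k l)"
  have U: "U \<in> carrier_mat (Suc n) (Suc n)" and L: "L \<in> carrier_mat (Suc n) (Suc n)"
    by (auto simp: U_def L_def)
  have last_row: "(\<Sum>j<n. u * (u * y j)) = u\<^sup>2 * s"
    by (simp add: s[symmetric] sum_distrib_left power2_eq_square mult_ac)
  have upper_rows: "(\<Sum>j<n. a k j * (u * y j)) = u * p" if "k < n" for k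
    by (simp add: y[OF that, symmetric] sum_distrib_left mult_ac)
  have "?B * U = L"
  proof (rule eq_matI)
    fix k l assume "k < dim_row L" "l < dim_col L"
    then have kl: "k < Suc n" "l < Suc n"
      using L by auto
    then have "(?B * U) $$ (k, l) = (\<Sum>j<Suc n. a k j * U $$ (j, l))"
      using U by (simp add: scalar_prod_def atLeast0LessThan)
    also have "\<dots> = (\<Sum>j<n. if l < n then if j = l then a k j else 0 else - (a k j * (u * y j)))
        + a k n * (if l < n then 0 else p)"
      using kl by (auto simp: U_def if_distrib[of "(*) (a k _)"] cong: if_cong intro!: sum.cong)
    also have "\<dots> = L $$ (k, l)"
      using kl
      by (auto simp: L_def y col row \<open>a n n = w\<close> sum_negf last_row upper_rows less_Suc_eq)
    finally show "(?B * U) $$ (k, l) = L $$ (k, l)" .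
  qed (use U L in auto)
  moreover have "det U = p"
    unfolding U_def by (subst det_four_block_mat_lower_left_zero[of _ n _ 1]) (auto simp: det_single)
  moreover have "det L = p * (w * p - u\<^sup>2 * s)"
    unfolding L_def by (subst det_four_block_mat_upper_right_zero_col[of _ n]) (auto simp: det_single det)
  moreover have "det (?B * U) = det ?B * det U"
    by (rule det_mult) (use U in auto)
  ultimately have "det ?B * p = p * (w * p - u\<^sup>2 * s)"
    by metis
  with \<open>p \<noteq> 0\<close> show ?thesis
    by (metis mult.commute mult_right_cancel)
qed

definition threshold_step :: "'a :: comm_ring_1 \<Rightarrow> 'a \<times> 'a \<Rightarrow> bool \<Rightarrow> 'a \<times> 'a" where
  "threshold_step x = (\<lambda>(p, s) c. if c then (x * p - s, (x + 2) * s + p) else (x * p, x * s + p))"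

text \<open>The later of two vertices decides their adjacency, hence \<open>max\<close>.\<close>

definition threshold_entry :: "bool list \<Rightarrow> nat \<Rightarrow> nat \<Rightarrow> complex poly" where
  "threshold_entry b k l = (if k = l then [:0, 1:] else if b ! max k l then - 1 else 0)"

lemma char_poly_matrix_threshold_graph:
  "char_poly_matrix (adjacency_matrix (threshold_graph b)) =
    mat (length b) (length b) (\<lambda>(k, l). threshold_entry b k l)"
  by (rule eq_matI)
    (auto simp: char_poly_matrix_def adjacency_matrix_def Let_def threshold_graph_def
      threshold_entry_def max_def one_pCons)

lemma char_poly_threshold_graph_nonzero: "char_poly (adjacency_matrix (threshold_graph b)) \<noteq> 0"
proof -
  have "adjacency_matrix (threshold_graph b) \<in> carrier_mat (length b) (length b)"
    by (simp add: adjacency_matrix_def Let_def)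
  from degree_monic_char_poly[OF this] show ?thesis
    by auto
qed

text \<open>Induction on the last bit. The invariant carries a vector \<open>y\<close> that the
  characteristic matrix sends to the constant vector \<open>p\<close>, with entry sum
  \<open>s\<close>: the data needed for the next border.\<close>

lemma char_poly_threshold_graph:
  "char_poly (adjacency_matrix (threshold_graph b)) = fst (foldl (threshold_step [:0, 1:]) (1, 0) b)"
proof -
  have "\<exists>y. char_poly (adjacency_matrix (threshold_graph b)) = p \<and>
      (\<forall>k<length b. (\<Sum>l<length b. threshold_entry b k l * y l) = p) \<and> (\<Sum>l<length b. y l) = s"
    if "foldl (threshold_step [:0, 1:]) (1, 0) b = (p, s)" for p s
    using that
  proof (induction b arbitrary: p s rule: rev_induct)
    case Nil
    then show ?case
      by (auto simp: char_poly_def char_poly_matrix_threshold_graph intro: det_dim_zero)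
  next
    case (snoc c b)
    obtain p' s' where ps': "foldl (threshold_step [:0, 1 :: complex:]) (1, 0) b = (p', s')"
      by fastforce
    from snoc.IH[OF this] obtain y where
      p': "char_poly (adjacency_matrix (threshold_graph b)) = p'"
      and y: "\<And>k. k < length b \<Longrightarrow> (\<Sum>l<length b. threshold_entry b k l * y l) = p'"
      and s': "(\<Sum>l<length b. y l) = s'"
      by blast
    define x :: "complex poly" where "x = [:0, 1:]"
    \<comment> \<open>As this border entry is 0 or -1, both branches of
      \<open>threshold_step\<close> become a single formula in \<open>u\<close>.\<close>
    define u :: "complex poly" where "u = - of_bool c"
    have "(p, s) = threshold_step x (p', s') c"
      using snoc.prems by (simp add: ps' x_def)
    then have p: "p = x * p' - u\<^sup>2 * s'" and s: "s = (x - 2 * u) * s' + p'"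
      by (auto simp: threshold_step_def u_def)
    have old: "threshold_entry (b @ [c]) k l = threshold_entry b k l"
      if "k < length b" "l < length b" for k l
      using that by (simp add: threshold_entry_def nth_append)
    have new: "threshold_entry (b @ [c]) k (length b) = u" "threshold_entry (b @ [c]) (length b) k = u"
      if "k < length b" for k
      using that by (auto simp: threshold_entry_def nth_append u_def)
    have diag: "threshold_entry (b @ [c]) (length b) (length b) = x"
      by (simp add: threshold_entry_def x_def)
    have "mat (length b) (length b) (\<lambda>(k, l). threshold_entry (b @ [c]) k l) =
        mat (length b) (length b) (\<lambda>(k, l). threshold_entry b k l)"
      by (rule eq_matI) (auto simp: old)
    then have "det (mat (length b) (length b) (\<lambda>(k, l). threshold_entry (b @ [c]) k l)) = p'"
      using p' by (simp add: char_poly_def char_poly_matrix_threshold_graph)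
    moreover have "p' \<noteq> 0"
      using char_poly_threshold_graph_nonzero p' by blast
    ultimately have det: "char_poly (adjacency_matrix (threshold_graph (b @ [c]))) = p"
      using det_border_constant[of "length b" "threshold_entry (b @ [c])" p' y s' u x] y s'
      by (simp add: old new diag p char_poly_def char_poly_matrix_threshold_graph)
    \<comment> \<open>Ansatz: a multiple of \<open>y\<close> on the old vertices and one new entry.
      These two coefficients make the old rows and the new row all yield \<open>p\<close>.\<close>
    define z where "z l = (if l < length b then (x - u) * y l else p' - u * s')" for l
    have "(\<Sum>l<length b. threshold_entry (b @ [c]) k l * z l) = (x - u) * p'" if "k < length b" for k
      using that by (simp add: z_def old y[OF that, symmetric] sum_distrib_left mult_ac)
    moreover have "(\<Sum>l<length b. threshold_entry (b @ [c]) (length b) l * z l) = u * (x - u) * s'"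
      by (simp add: z_def new s'[symmetric] sum_distrib_left mult_ac)
    ultimately have "(\<Sum>l<Suc (length b). threshold_entry (b @ [c]) k l * z l) = p"
      if "k < Suc (length b)" for k
      using that
      by (auto simp: less_Suc_eq new diag p z_def algebra_simps power2_eq_square)
    moreover have "(\<Sum>l<length b. z l) = (x - u) * s'"
      by (simp add: z_def s'[symmetric] sum_distrib_left)
    then have "(\<Sum>l<Suc (length b). z l) = s"
      by (simp add: z_def s algebra_simps)
    ultimately show ?case
      using det by auto
  qed
  then show ?thesis
    by (metis prod.collapse)
qed

section \<open>Blocks of equal bits\<close>

text \<open>
  The powers of \<open>x\<close> and \<open>x + 1\<close> are split off on both sides, so that the following two rules can be
  chained along the blocks.
\<close>

lemma foldl_threshold_step_isolated:
  assumes "m > 0"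
  shows "foldl (threshold_step x) (x ^ a * (x + 1) ^ b * p, x ^ a * (x + 1) ^ b * s) (replicate m False) =
    (x ^ (a + m - 1) * (x + 1) ^ b * (x * p), x ^ (a + m - 1) * (x + 1) ^ b * (x * s + of_nat m * p))"
proof -
  \<comment> \<open>One step is \<open>x\<close> times the identity plus the map from
    \<open>(p, s)\<close> to \<open>(0, p)\<close>, which squares to zero, so only two binomial
    terms survive in the iterate.\<close>
  have "foldl (threshold_step x) (x ^ a * r * p, x ^ a * r * s) (replicate (Suc k) False) =
      (x ^ (a + k) * r * (x * p), x ^ (a + k) * r * (x * s + of_nat (Suc k) * p))" for k r
  proof (induction k)
    case (Suc k)
    have "replicate (Suc (Suc k)) False = replicate (Suc k) False @ [False]"
      by (simp add: replicate_append_same)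
    then show ?case
      by (simp only: foldl_append Suc.IH) (simp add: threshold_step_def algebra_simps)
  qed (simp add: threshold_step_def algebra_simps)
  from this[where k = "m - 1"] assms show ?thesis
    by simp
qed

lemma foldl_threshold_step_dominating:
  assumes "m > 0"
  shows "foldl (threshold_step x) (x ^ a * (x + 1) ^ b * p, x ^ a * (x + 1) ^ b * s) (replicate m True) =
    (x ^ a * (x + 1) ^ (b + m - 1) * ((x + 1) * p - of_nat m * (p + s)),
     x ^ a * (x + 1) ^ (b + m - 1) * ((x + 1) * s + of_nat m * (p + s)))"
proof -
  \<comment> \<open>Here the step is \<open>x + 1\<close> times the identity plus the map from
    \<open>(p, s)\<close> to \<open>(- (p + s), p + s)\<close>, again of square zero.\<close>
  have "foldl (threshold_step x) (r * (x + 1) ^ b * p, r * (x + 1) ^ b * s) (replicate (Suc k) True) =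
      (r * (x + 1) ^ (b + k) * ((x + 1) * p - of_nat (Suc k) * (p + s)),
       r * (x + 1) ^ (b + k) * ((x + 1) * s + of_nat (Suc k) * (p + s)))" for k r
  proof (induction k)
    case (Suc k)
    have "replicate (Suc (Suc k)) True = replicate (Suc k) True @ [True]"
      by (simp add: replicate_append_same)
    then show ?case
      by (simp only: foldl_append Suc.IH) (simp add: threshold_step_def algebra_simps)
  qed (simp add: threshold_step_def algebra_simps)
  from this[where k = "m - 1"] assms show ?thesis
    by simp
qed

section \<open>The two characteristic polynomials\<close>

definition common_quartic :: "'a \<Rightarrow> 'a \<Rightarrow> 'a :: comm_ring_1" where
  "common_quartic k x = x ^ 4 - (8 * k + 2) * x ^ 3 + (8 * k\<^sup>2 - 4 * k - 3) * x\<^sup>2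
     + (8 * k ^ 3 + 20 * k\<^sup>2 + 8 * k) * x - 4 * k\<^sup>2 * (k + 1) * (2 * k + 1)"

text \<open>
  The powers of \<open>x\<close> and \<open>x + 1\<close> come from twin vertices; what remains for each of the two graphs is a
  quintic, and the quartic is their greatest common divisor. The exponent \<open>3 * i - 1\<close> is a truncated
  subtraction.
\<close>

definition common_factor :: "nat \<Rightarrow> 'a \<Rightarrow> 'a :: comm_ring_1" where
  "common_factor i x = x ^ (3 * i - 1) * (x + 1) ^ (6 * i) * common_quartic (of_nat i) x"

lemma fst_foldl_threshold_step_G:
  fixes x :: "'a :: comm_ring_1"
  assumes "i \<ge> 1"
  shows "fst (foldl (threshold_step x) (1, 0)
      ([False] @ replicate (2 * i + 1) True @ replicate i False @ replicate (2 * i + 2) True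
        @ replicate (2 * i + 1) False @ replicate (2 * i) True)) =
    common_factor i x * ((x + 1) * (x + (2 * of_nat i + 1)))"
proof -
  have start: "foldl (threshold_step x) (1, 0) [False] =
      (x ^ 0 * (x + 1) ^ 0 * x, x ^ 0 * (x + 1) ^ 0 * 1)"
    by (simp add: threshold_step_def)
  have pos: "0 < i" "0 < 2 * i" "0 < 2 * i + 1" "0 < 2 * i + 2" "0 < i + 1"
    using assms by auto
  \<comment> \<open>The exponents are left as the chained rules produce them: after the initial
    zero, a block of size \<open>m\<close> adds \<open>m - 1\<close> to one of them.\<close>
  have "fst (foldl (threshold_step x) (1, 0)
      ([False] @ replicate (2 * i + 1) True @ replicate i False @ replicate (2 * i + 2) True
        @ replicate (2 * i + 1) False @ replicate (2 * i) True)) =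
    x ^ (0 + i - 1 + (2 * i + 1) - 1) * (x + 1) ^ (0 + (2 * i + 1) - 1 + (2 * i + 2) - 1 + 2 * i - 1) *
      (common_quartic (of_nat i) x * ((x + 1) * (x + (2 * of_nat i + 1))))"
    by (simp only: foldl_append start pos foldl_threshold_step_isolated
        foldl_threshold_step_dominating fst_conv)
      (rule arg_cong2[of _ _ _ _ "(*)"],
        simp_all only: common_quartic_def of_nat_add of_nat_mult of_nat_numeral of_nat_1,
        simp add: eval_nat_numeral algebra_simps)
  moreover have "0 + i - 1 + (2 * i + 1) - 1 = 3 * i - 1"
    "0 + (2 * i + 1) - 1 + (2 * i + 2) - 1 + 2 * i - 1 = 6 * i"
    using assms by auto
  ultimately show ?thesis
    by (simp only: common_factor_def mult.assoc)
qed

lemma fst_foldl_threshold_step_G':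
  fixes x :: "'a :: comm_ring_1"
  assumes "i \<ge> 1"
  shows "fst (foldl (threshold_step x) (1, 0)
      ([False] @ replicate (2 * i) True @ replicate (i + 1) False @ replicate (2 * i) True
        @ replicate (2 * i + 1) False @ replicate (2 * i + 2) True)) =
    common_factor i x * (x * (x + (2 * of_nat i + 2)))"
proof -
  have start: "foldl (threshold_step x) (1, 0) [False] =
      (x ^ 0 * (x + 1) ^ 0 * x, x ^ 0 * (x + 1) ^ 0 * 1)"
    by (simp add: threshold_step_def)
  have pos: "0 < i" "0 < 2 * i" "0 < 2 * i + 1" "0 < 2 * i + 2" "0 < i + 1"
    using assms by auto
  have "fst (foldl (threshold_step x) (1, 0)
      ([False] @ replicate (2 * i) True @ replicate (i + 1) False @ replicate (2 * i) True
        @ replicate (2 * i + 1) False @ replicate (2 * i + 2) True)) =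
    x ^ (0 + (i + 1) - 1 + (2 * i + 1) - 1) * (x + 1) ^ (0 + 2 * i - 1 + 2 * i - 1 + (2 * i + 2) - 1) *
      (common_quartic (of_nat i) x * ((x + 1) * (x + (2 * of_nat i + 2))))"
    by (simp only: foldl_append start pos foldl_threshold_step_isolated
        foldl_threshold_step_dominating fst_conv)
      (rule arg_cong2[of _ _ _ _ "(*)"],
        simp_all only: common_quartic_def of_nat_add of_nat_mult of_nat_numeral of_nat_1,
        simp add: eval_nat_numeral algebra_simps)
  \<comment> \<open>Compared with the other sequence, there is one more \<open>x\<close> and one
    fewer \<open>x + 1\<close> among the powers; the \<open>x + 1\<close> in the last factor
    completes \<open>(x + 1) ^ (6 * i)\<close>.\<close>
  moreover have "0 + (i + 1) - 1 + (2 * i + 1) - 1 = Suc (3 * i - 1)"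
    "0 + 2 * i - 1 + 2 * i - 1 + (2 * i + 2) - 1 = 6 * i - 1"
    using assms by auto
  moreover have "(x + 1) ^ (6 * i) = (x + 1) ^ (6 * i - 1) * (x + 1)"
    using assms by (metis One_nat_def power_minus_mult mult_pos_pos zero_less_numeral less_eq_Suc_le)
  ultimately show ?thesis
    by (simp only: common_factor_def power_Suc mult_ac)
qed

section \<open>Spectra and energies\<close>

lemma proots_linear_mult:
  fixes r :: "'a :: idom poly"
  assumes "r * ([:a, 1:] * [:b, 1:]) \<noteq> 0"
  shows "proots (r * ([:a, 1:] * [:b, 1:])) = proots r + {#- a, - b#}"
  using assms by (auto simp: proots_mult simp del: mult_pCons_left mult_pCons_right)

theorem theorem4:
  fixes i n :: nat and G G' :: "nat pair_pre_digraph"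
  assumes "i \<ge> 1" and "n = 9 * i + 5"
    and "G = threshold_graph
      ([False] @ replicate (2 * i + 1) True @ replicate i False @ replicate (2 * i + 2) True
        @ replicate (2 * i + 1) False @ replicate (2 * i) True)"
    and "G' = threshold_graph
      ([False] @ replicate (2 * i) True @ replicate (i + 1) False @ replicate (2 * i) True
        @ replicate (2 * i + 1) False @ replicate (2 * i + 2) True)"
  shows "card (pverts G) = n \<and> card (pverts G') = n \<and> \<not> cospectral G G' \<and> equienergetic G G'"
proof -
  let ?r = "common_factor i [:0, 1:] :: complex poly"
  have linear: "[:0, 1:] + 1 = [:1, 1 :: complex:]"
    "[:0, 1:] + (2 * of_nat i + 1) = [:of_nat (2 * i + 1), 1 :: complex:]"
    "[:0, 1:] + (2 * of_nat i + 2) = [:of_nat (2 * i + 2), 1 :: complex:]"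
    by (simp_all add: of_nat_poly numeral_poly one_pCons)
  have "char_poly (adjacency_matrix G) = ?r * ([:1, 1:] * [:of_nat (2 * i + 1), 1:])"
    by (simp only: assms(3) char_poly_threshold_graph fst_foldl_threshold_step_G[OF \<open>i \<ge> 1\<close>] linear)
  then have G: "adjacency_spectrum G = proots ?r + {#- 1, - of_nat (2 * i + 1)#}"
    using proots_linear_mult char_poly_threshold_graph_nonzero assms(3)
    unfolding adjacency_spectrum_def by metis
  have "char_poly (adjacency_matrix G') = ?r * ([:0, 1:] * [:of_nat (2 * i + 2), 1:])"
    by (simp only: assms(4) char_poly_threshold_graph fst_foldl_threshold_step_G'[OF \<open>i \<ge> 1\<close>] linear)
  then have G': "adjacency_spectrum G' = proots ?r + {#- 0, - of_nat (2 * i + 2)#}"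
    using proots_linear_mult char_poly_threshold_graph_nonzero assms(4)
    unfolding adjacency_spectrum_def by metis
  \<comment> \<open>Since 0 is also a root of \<open>?r\<close>, its mere presence does not separate
    the spectra; \<open>proots ?r\<close> is cancelled first and the remaining pairs are
    compared.\<close>
  have "of_nat (2 * i + 1) \<noteq> (0 :: complex)"
    by (simp only: of_nat_eq_0_iff)
  then have "0 \<notin># {#- 1, - of_nat (2 * i + 1) :: complex#}"
    by (simp del: of_nat_add of_nat_mult of_nat_Suc)
  moreover have "0 \<in># {#- 0, - of_nat (2 * i + 2) :: complex#}"
    by simp
  ultimately have "\<not> cospectral G G'"
    unfolding cospectral_def G G' by (metis add_left_cancel)
  moreover have "equienergetic G G'"
  proof -
    have "cmod (- of_nat k) = real k" for k
      by simp
    then show ?thesis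
      by (simp only: equienergetic_def energy_def G G' image_mset_union sum_mset.union image_mset_add_mset
          image_mset_empty sum_mset.add_mset sum_mset.empty) simp
  qed
  ultimately show ?thesis
    using assms by simp
qed

end
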